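(* Let $n \ge 1$ be an integer and let $p$ be a prime with $p < 2n+1$ such that $2n+p$ is prime. Then the ladder $P_n \times P_2$ has a consecutive cyclic prime labeling. Moreover, such a labeling is realized by assigning the label $1$ to the top row vertex located $\frac{1}{2}(p-1)-1$ places from (i.e., to the left of) the top right vertex $v_n$, that is, to the vertex $v_i$ with $i = n - \left(\frac{1}{2}(p-1)-1\right)$.
   Context: The ladder $P_n \times P_2$ is the simple graph with $2n$ vertices $v_1, \ldots, v_n$ (top row, left to right) and $u_1, \ldots, u_n$ (bottom row, left to right), whose edges are $v_i u_i$ for $1 \le i \le n$, and $v_i v_{i+1}$, $u_i u_{i+1}$ for $1 \le i \le n-1$. A prime labeling of a simple graph with $N$ vertices is a bijection from its vertex set to $\{1, 2, \ldots, N\}$ such that the labels of any two adjacent vertices are relatively prime. A consecutive cyclic labeling of $P_n \times P_2$ is a bijective labeling of its vertices by $\{1, \ldots, 2n\}$ in which the labels wrap consecutively (clockwise) around the ladder: arranging the vertices in the cyclic order $v_1, v_2, \ldots, v_n, u_n, u_{n-1}, \ldots, u_1$ (then back to $v_1$), the label $1$ is placed on some vertex and the labels $2, 3, \ldots, 2n$ are placed successively on the following vertices in this cyclic order. (So if $1$ is on $v_i$, then $v_n$ has label $n-i+1$, $u_n$ has label $n-i+2$, $u_1$ has label $2n-i+1$, and, if $i \ge 2$, $v_1$ has label $2n-i+2$ and $v_{i-1}$ has label $2n$.) A consecutive cyclic prime labeling is a consecutive cyclic labeling that is also a prime labeling. *)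

theory Defs
  imports Complex_Main "HOL-Computational_Algebra.Primes"
begin

text \<open>A graph is a pair of a vertex set and a set of unordered edges.\<close>

type_synonym 'a graph = "'a set \<times> 'a set set"

definition simple_graph :: "'a graph \<Rightarrow> bool" where
  "simple_graph G \<longleftrightarrow> finite (fst G) \<and> (\<forall>e \<in> snd G. e \<subseteq> fst G \<and> card e = 2)"

definition adjacent :: "'a graph \<Rightarrow> 'a \<Rightarrow> 'a \<Rightarrow> bool" where
  "adjacent G x y \<longleftrightarrow> {x, y} \<in> snd G"

text \<open>Labelings are total functions; only their values on the vertex set matter.\<close>

definition prime_labeling :: "'a graph \<Rightarrow> ('a \<Rightarrow> nat) \<Rightarrow> bool" where
  "prime_labeling G f \<longleftrightarrow>
     bij_betw f (fst G) {1..card (fst G)} \<and>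
     (\<forall>x \<in> fst G. \<forall>y \<in> fst G. adjacent G x y \<longrightarrow> coprime (f x) (f y))"

text \<open>\<open>Top i\<close> is $v_i$ and \<open>Bottom i\<close> is $u_i$, with indices starting at 1.\<close>

datatype ladder_vertex = Top nat | Bottom nat

definition ladder :: "nat \<Rightarrow> ladder_vertex graph" where
  "ladder n =
     (Top ` {1..n} \<union> Bottom ` {1..n},
      {{Top i, Bottom i} | i. 1 \<le> i \<and> i \<le> n} \<union>
      {{Top i, Top (i + 1)} | i. 1 \<le> i \<and> i + 1 \<le> n} \<union>
      {{Bottom i, Bottom (i + 1)} | i. 1 \<le> i \<and> i + 1 \<le> n})"

lemma simple_graph_ladder: "simple_graph (ladder n)"
  by (auto simp: simple_graph_def ladder_def card_insert_if)

lemma card_ladder: "card (fst (ladder n)) = 2 * n"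
proof -
  have "card (Top ` {1..n} \<union> Bottom ` {1..n}) = card (Top ` {1..n}) + card (Bottom ` {1..n})"
    by (rule card_Un_disjoint) auto
  then show ?thesis
    by (simp add: ladder_def card_image inj_on_def)
qed

text \<open>The clockwise order $v_1, \ldots, v_n, u_n, \ldots, u_1$.\<close>

definition ladder_cycle :: "nat \<Rightarrow> ladder_vertex list" where
  "ladder_cycle n = map Top [1..<n + 1] @ rev (map Bottom [1..<n + 1])"

text \<open>Here \<open>k\<close> is the position, counted from 0, of the vertex labeled 1 in the clockwise order.\<close>

definition consecutive_cyclic_labeling :: "nat \<Rightarrow> (ladder_vertex \<Rightarrow> nat) \<Rightarrow> bool" where
  "consecutive_cyclic_labeling n f \<longleftrightarrow>
     bij_betw f (fst (ladder n)) {1..2 * n} \<and>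
     (\<exists>k < 2 * n. \<forall>j < 2 * n. f (ladder_cycle n ! ((k + j) mod (2 * n))) = j + 1)"

definition consecutive_cyclic_prime_labeling :: "nat \<Rightarrow> (ladder_vertex \<Rightarrow> nat) \<Rightarrow> bool" where
  "consecutive_cyclic_prime_labeling n f \<longleftrightarrow>
     consecutive_cyclic_labeling n f \<and> prime_labeling (ladder n) f"

end

theory Submission
  imports Defs
begin

text \<open>
  Two positive numbers whose sum is prime are coprime, so it suffices to place the consecutive
  labels in such a way that every rung of the ladder has a prime label sum. Around the cycle the
  top labels grow to the right while the bottom labels grow to the left, so the sum on a rung is
  constant as long as no wrap-around takes place; passing from \<open>2 n\<close> back to \<open>1\<close> in the top row
  changes it by \<open>2 n\<close>. Only two sums therefore occur. If \<open>m\<close> labels precede the bottom right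
  corner, the corner column carries \<open>m\<close> and \<open>m + 1\<close>, so the sums are \<open>2 m + 1\<close> and
  \<open>2 n + 2 m + 1\<close>. With \<open>m = (p - 1) / 2\<close> these are the primes \<open>p\<close> and \<open>2 n + p\<close>. The remaining
  edges run along the rows, where the labels are consecutive integers or, at the place of the
  wrap-around, \<open>2 n\<close> and \<open>1\<close>.

  The case \<open>p = 2\<close> cannot arise, because \<open>2 n + 2\<close> is even and exceeds \<open>2\<close>.
\<close>

text \<open>
  The parameter \<open>m\<close> is the number of labels on the top row before the labels turn the corner: for
  \<open>1 \<le> m\<close> and \<open>m \<le> n\<close>, the label \<open>1\<close> sits on \<open>Top (n - m + 1)\<close> and the label \<open>m\<close> on \<open>Top n\<close>.
\<close>

fun shifted_label :: "nat \<Rightarrow> nat \<Rightarrow> ladder_vertex \<Rightarrow> nat" where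
  "shifted_label n m (Top j) = (if n < j + m then j + m - n else j + m + n)"
| "shifted_label n m (Bottom j) = n + m + 1 - j"

lemma coprime_if_prime_add:
  fixes a b :: nat
  assumes "prime (a + b)" and "0 < a" and "0 < b"
  shows "coprime a b"
proof -
  have "gcd a b dvd a + b"
    by simp
  then have "gcd a b = 1 \<or> gcd a b = a + b"
    using assms(1) by (auto simp: prime_nat_iff)
  moreover have "gcd a b \<le> a"
    using assms(2) by (simp add: gcd_le1_nat)
  ultimately show ?thesis
    using assms(3) by (simp add: coprime_iff_gcd_eq_1)
qed

lemma nth_ladder_cycle:
  assumes "q < 2 * n"
  shows "ladder_cycle n ! q = (if q < n then Top (q + 1) else Bottom (2 * n - q))"
  using assms by (auto simp: ladder_cycle_def nth_append rev_nth simp del: upt_Suc)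

lemma bij_betw_shifted_label:
  assumes "m \<le> n"
  shows "bij_betw (shifted_label n m) (fst (ladder n)) {1..2 * n}"
proof -
  \<comment> \<open>The top row carries \<open>{1..m}\<close> and \<open>{n + m + 1..2 * n}\<close>, the bottom row \<open>{m + 1..n + m}\<close>;
    these are disjoint, which makes the mixed cases arithmetically impossible.\<close>
  have inj: "inj_on (shifted_label n m) (fst (ladder n))"
    using assms by (auto simp: inj_on_def ladder_def split: if_splits)
  have sub: "shifted_label n m ` fst (ladder n) \<subseteq> {1..2 * n}"
    using assms by (auto simp: ladder_def)
  have "card (shifted_label n m ` fst (ladder n)) = card {1..2 * n}"
    using inj by (simp add: card_image card_ladder)
  with sub have "shifted_label n m ` fst (ladder n) = {1..2 * n}"
    by (intro card_subset_eq) auto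
  with inj show ?thesis
    by (simp add: bij_betw_def)
qed

lemma consecutive_cyclic_labeling_shifted_label:
  assumes "1 \<le> n" and "m \<le> n"
  shows "consecutive_cyclic_labeling n (shifted_label n m)"
proof -
  have "shifted_label n m (ladder_cycle n ! ((n - m + j) mod (2 * n))) = j + 1"
    if "j < 2 * n" for j
  proof (cases "n - m + j < 2 * n")
    case True
    then show ?thesis
      using assms by (auto simp: nth_ladder_cycle)
  next
    case False
    then have "(n - m + j) mod (2 * n) = n - m + j - 2 * n"
      using that assms by (simp add: le_mod_geq)
    then show ?thesis
      using False that assms by (auto simp: nth_ladder_cycle)
  qed
  moreover have "n - m < 2 * n"
    using assms by simp
  ultimately show ?thesis
    using bij_betw_shifted_label[OF assms(2)]
    unfolding consecutive_cyclic_labeling_def by blast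
qed

lemma prime_labeling_shifted_label:
  assumes "m \<le> n" and "prime (2 * m + 1)" and "prime (2 * n + 2 * m + 1)"
  shows "prime_labeling (ladder n) (shifted_label n m)"
proof -
  let ?f = "shifted_label n m"
  have rung: "coprime (?f (Top i)) (?f (Bottom i))" if "1 \<le> i" "i \<le> n" for i
  proof (rule coprime_if_prime_add)
    have "?f (Top i) + ?f (Bottom i) = (if n < i + m then 2 * m + 1 else 2 * n + 2 * m + 1)"
      using that by auto
    then show "prime (?f (Top i) + ?f (Bottom i))"
      using assms by simp
  qed (use that in auto)
  have top: "coprime (?f (Top i)) (?f (Top (i + 1)))" for i
  proof -
    \<comment> \<open>The first alternative is the wrap-around from \<open>2 * n\<close> to \<open>1\<close>.\<close>
    have "?f (Top (i + 1)) = 1 \<or> ?f (Top (i + 1)) = Suc (?f (Top i))"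
      by auto
    then show ?thesis
      by (metis coprime_1_right coprime_Suc_right_nat)
  qed
  have bottom: "coprime (?f (Bottom i)) (?f (Bottom (i + 1)))" if "i + 1 \<le> n" for i
  proof -
    have "?f (Bottom i) = Suc (?f (Bottom (i + 1)))"
      using that by auto
    then show ?thesis
      by (metis coprime_Suc_left_nat)
  qed
  have "coprime (?f x) (?f y)" if adj: "adjacent (ladder n) x y" for x y
  proof -
    consider i where "1 \<le> i" "i \<le> n" "{x, y} = {Top i, Bottom i}"
      | i where "{x, y} = {Top i, Top (i + 1)}"
      | i where "i + 1 \<le> n" "{x, y} = {Bottom i, Bottom (i + 1)}"
      using adj unfolding adjacent_def ladder_def snd_conv Un_iff mem_Collect_eq by blast
    then show ?thesis
      using rung top bottom by cases (metis coprime_commute doubleton_eq_iff)+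
  qed
  then show ?thesis
    using bij_betw_shifted_label[OF assms(1)]
    by (simp add: prime_labeling_def card_ladder)
qed

theorem theorem8:
  fixes n p :: nat
  assumes "n \<ge> 1" and "prime p" and "p < 2 * n + 1" and "prime (2 * n + p)"
  shows "(\<exists>f. consecutive_cyclic_prime_labeling n f) \<and>
    (\<exists>i \<in> {1..n}. real i = real n - (1 / 2 * (real p - 1) - 1) \<and>
       (\<exists>f. consecutive_cyclic_prime_labeling n f \<and> f (Top i) = 1))"
proof -
  have "odd (2 * n + p)"
    using assms(1,4) prime_ge_2_nat[OF assms(2)] by (intro prime_odd_nat) auto
  then obtain m where p: "p = 2 * m + 1"
    by (auto elim: oddE)
  have m: "1 \<le> m" "m \<le> n"
    using prime_ge_2_nat[OF assms(2)] assms(3) p by auto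
  let ?f = "shifted_label n m"
  have f: "consecutive_cyclic_prime_labeling n ?f"
    using consecutive_cyclic_labeling_shifted_label prime_labeling_shifted_label assms m p
    by (simp add: consecutive_cyclic_prime_labeling_def)
  have "n - m + 1 \<in> {1..n}"
    using m by auto
  moreover have "real (n - m + 1) = real n - (1 / 2 * (real p - 1) - 1)"
    using m p by (simp add: of_nat_diff)
  moreover have "?f (Top (n - m + 1)) = 1"
    using m by simp
  ultimately show ?thesis
    using f by blast
qed

end
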